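(* Let $\mathcal{A}$, $\mathcal{P}_{\mathcal{D}}$, $\mathbf{S}$ and the symmetric positive definite matrix $\widehat{\mathbf{S}}$ be as defined in the context, and let $0<\lambda_{\mathbf{S}}\le\Lambda_{\mathbf{S}}$ be such that all eigenvalues of $\widehat{\mathbf{S}}^{-1}\mathbf{S}$ lie in $[\lambda_{\mathbf{S}},\Lambda_{\mathbf{S}}]$. Then the eigenvalues of $\mathcal{P}_{\mathcal{D}}^{-1}\mathcal{A}$ are real, and satisfy $$\lambda(\mathcal{P}_{\mathcal{D}}^{-1}\mathcal{A})\subset\left[\frac{1-\sqrt{1+4\Lambda_{\mathbf{S}}}}{2},\frac{1-\sqrt{1+4\lambda_{\mathbf{S}}}}{2}\right]\cup\{1\}\cup\left[\frac{1+\sqrt{1+4\lambda_{\mathbf{S}}}}{2},\frac{1+\sqrt{1+4\Lambda_{\mathbf{S}}}}{2}\right].$$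
   Context: $N,s,p\ge1$ are integers. $B,Q_1,\dots,Q_N\in\mathbb{R}^{s\times s}$ and $R_0,\dots,R_N\in\mathbb{R}^{p\times p}$ are symmetric positive definite, $H_0,\dots,H_N\in\mathbb{R}^{p\times s}$, $M\in\mathbb{R}^{s\times s}$. $\mathbf{D}=\mathrm{blkdiag}(B,Q_1,\dots,Q_N)$, $\mathbf{R}=\mathrm{blkdiag}(R_0,\dots,R_N)$, $\mathbf{H}=\mathrm{blkdiag}(H_0,\dots,H_N)$, and $\mathbf{L}=I_{N+1}\otimes I_s-\Sigma\otimes M$, where $\Sigma\in\mathbb{R}^{(N+1)\times(N+1)}$ has ones on the first subdiagonal and zeros elsewhere. Define $\mathbf{S}=\mathbf{L}^T\mathbf{D}^{-1}\mathbf{L}+\mathbf{H}^T\mathbf{R}^{-1}\mathbf{H}$, $$\mathcal{A}=\begin{pmatrix}\mathbf{D}&0&\mathbf{L}\\0&\mathbf{R}&\mathbf{H}\\ \mathbf{L}^T&\mathbf{H}^T&0\end{pmatrix},\qquad \mathcal{P}_{\mathcal{D}}=\begin{pmatrix}\mathbf{D}&0&0\\0&\mathbf{R}&0\\0&0&\widehat{\mathbf{S}}\end{pmatrix},$$ where $\widehat{\mathbf{S}}\in\mathbb{R}^{(N+1)s\times(N+1)s}$ is a symmetric positive definite approximation to $\mathbf{S}$. $\lambda(A)$ denotes the spectrum of $A$. *)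

theory Defs
  imports Complex_Main "Jordan_Normal_Form.Spectral_Radius"
    "Jordan_Normal_Form.Gauss_Jordan_Elimination"
begin

definition spd_mat :: "nat \<Rightarrow> real mat \<Rightarrow> bool" where
  "spd_mat n A \<longleftrightarrow> A \<in> carrier_mat n n \<and> transpose_mat A = A \<and>
     (\<forall>v \<in> carrier_vec n. v \<noteq> 0\<^sub>v n \<longrightarrow> 0 < v \<bullet> (A *\<^sub>v v))"

(* Only meaningful for invertible matrices; otherwise an unspecified value. *)
definition mat_inv :: "'a :: field mat \<Rightarrow> 'a mat" where
  "mat_inv A = the (mat_inverse A)"

(* The spectrum of a real matrix, taken in the complex numbers. *)
definition cspectrum :: "real mat \<Rightarrow> complex set" where
  "cspectrum A = spectrum (map_mat complex_of_real A)"

definition kronecker :: "'a :: times mat \<Rightarrow> 'a mat \<Rightarrow> 'a mat" where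
  "kronecker A B = mat (dim_row A * dim_row B) (dim_col A * dim_col B)
     (\<lambda>(i, j). A $$ (i div dim_row B, j div dim_col B) * B $$ (i mod dim_row B, j mod dim_col B))"

definition subdiag_mat :: "nat \<Rightarrow> real mat" where
  "subdiag_mat n = mat n n (\<lambda>(i, j). if i = j + 1 then 1 else 0)"

definition D_mat :: "nat \<Rightarrow> real mat \<Rightarrow> (nat \<Rightarrow> real mat) \<Rightarrow> real mat" where
  "D_mat N B Q = diag_block_mat (B # map Q [1..<N + 1])"

definition R_mat :: "nat \<Rightarrow> (nat \<Rightarrow> real mat) \<Rightarrow> real mat" where
  "R_mat N R = diag_block_mat (map R [0..<N + 1])"

definition H_mat :: "nat \<Rightarrow> (nat \<Rightarrow> real mat) \<Rightarrow> real mat" where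
  "H_mat N H = diag_block_mat (map H [0..<N + 1])"

definition L_mat :: "nat \<Rightarrow> nat \<Rightarrow> real mat \<Rightarrow> real mat" where
  "L_mat N s M = kronecker (1\<^sub>m (N + 1)) (1\<^sub>m s) - kronecker (subdiag_mat (N + 1)) M"

(* In the following definitions D, R, H and L denote the assembled block matrices. *)

definition S_mat :: "real mat \<Rightarrow> real mat \<Rightarrow> real mat \<Rightarrow> real mat \<Rightarrow> real mat" where
  "S_mat D R H L = transpose_mat L * mat_inv D * L + transpose_mat H * mat_inv R * H"

(* L @\<^sub>r H stacks L on top of H, so its transpose is the block row (L^T, H^T). *)
definition saddle_mat :: "real mat \<Rightarrow> real mat \<Rightarrow> real mat \<Rightarrow> real mat \<Rightarrow> real mat" where
  "saddle_mat D R H L =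
     four_block_mat (diag_block_mat [D, R]) (L @\<^sub>r H)
                    (transpose_mat (L @\<^sub>r H)) (0\<^sub>m (dim_col L) (dim_col L))"

definition prec_diag :: "real mat \<Rightarrow> real mat \<Rightarrow> real mat \<Rightarrow> real mat" where
  "prec_diag D R Shat = diag_block_mat [D, R, Shat]"

end

theory Submission
  imports Defs
begin

text \<open>Write \<open>G = blkdiag(D, R)\<close> and let \<open>K\<close> be the block column with entries \<open>L\<close> and \<open>H\<close>,
  so that \<open>S = K\<^sup>T G\<^sup>-\<^sup>1 K\<close>. An eigenpair with eigenvalue \<open>\<mu> \<noteq> 1\<close> and eigenvector \<open>(w, z)\<close> satisfies
  \<open>K z = (\<mu> - 1) G w\<close> and \<open>K\<^sup>T w = \<mu> Shat z\<close>. Eliminating \<open>w\<close> gives \<open>S z = \<mu> (\<mu> - 1) Shat z\<close>,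
  where \<open>z \<noteq> 0\<close> as otherwise \<open>w = 0\<close> too. Hence \<open>\<mu> (\<mu> - 1)\<close> is an eigenvalue of \<open>Shat\<^sup>-\<^sup>1 S\<close>,
  and \<open>\<mu>\<close> is a root of the quadratic \<open>\<mu>\<^sup>2 - \<mu> - \<lambda>\<close> with \<open>\<lambda>\<close> in the given interval.\<close>

section \<open>Invertibility and dimensions of block-diagonal matrices\<close>

lemma spd_mat_det_nonzero:
  assumes "spd_mat n A"
  shows "det A \<noteq> 0"
proof
  assume "det A = 0"
  moreover have A: "A \<in> carrier_mat n n" using assms unfolding spd_mat_def by auto
  ultimately obtain v where v: "v \<in> carrier_vec n" "v \<noteq> 0\<^sub>v n" "A *\<^sub>v v = 0\<^sub>v n"
    using det_0_iff_vec_prod_zero by blast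
  then have "0 < v \<bullet> 0\<^sub>v n" using assms unfolding spd_mat_def by metis
  with v(1) show False by simp
qed

text \<open>A nonzero determinant makes \<open>A\<close> a unit, which rules out the outcome
  \<open>None\<close> of Gauss-Jordan elimination; so \<open>the\<close> in \<open>mat_inv\<close>
  returns a genuine two-sided inverse.\<close>

lemma mat_inv:
  fixes A :: "'a :: field mat"
  assumes A: "A \<in> carrier_mat n n" and "det A \<noteq> 0"
  shows "A * mat_inv A = 1\<^sub>m n" "mat_inv A * A = 1\<^sub>m n" "mat_inv A \<in> carrier_mat n n"
proof -
  obtain C where C: "mat_inverse A = Some C"
    using mat_inverse(1)[OF A, of "()"] det_non_zero_imp_unit[OF assms, of "()"]
    by (cases "mat_inverse A") auto
  with mat_inverse(2)[OF A C]
  show "A * mat_inv A = 1\<^sub>m n" "mat_inv A * A = 1\<^sub>m n" "mat_inv A \<in> carrier_mat n n"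
    unfolding mat_inv_def by auto
qed

lemma diag_block_mat_carrier:
  assumes "\<And>A. A \<in> set As \<Longrightarrow> A \<in> carrier_mat m n"
  shows "diag_block_mat As \<in> carrier_mat (length As * m) (length As * n)"
proof -
  have "sum_list (map dim_row As) = length As * m \<and> sum_list (map dim_col As) = length As * n"
    using assms by (induction As) auto
  then show ?thesis
    by (intro carrier_matI) (simp_all add: dim_diag_block_mat)
qed

text \<open>Each step of the recursion is a block triangular matrix, whose determinant is the
  product over its two diagonal blocks. Blocks may differ in size, as they do in
  \<open>prec_diag\<close>.\<close>

lemma det_diag_block_mat:
  fixes As :: "'a :: idom mat list"
  assumes "\<forall>A \<in> set As. square_mat A"
  shows "det (diag_block_mat As) = prod_list (map det As)"
  using assms
proof (induction As)
  case Nil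
  then show ?case by simp
next
  case (Cons A As)
  have "square_mat (diag_block_mat As)" using Cons.prems by (intro diag_block_mat_square) auto
  then obtain m where C: "diag_block_mat As \<in> carrier_mat m m" by auto
  from Cons.prems obtain n where A: "A \<in> carrier_mat n n" by auto
  have "det (diag_block_mat (A # As)) = det A * det (diag_block_mat As)"
    using det_four_block_mat_lower_left_zero[OF A zero_carrier_mat refl C]
      carrier_matD[OF A] carrier_matD[OF C] by (simp add: Let_def)
  then show ?case using Cons by simp
qed

lemma det_diag_block_mat_nonzero:
  fixes As :: "'a :: idom mat list"
  assumes "\<And>A. A \<in> set As \<Longrightarrow> A \<in> carrier_mat n n \<and> det A \<noteq> 0"
  shows "det (diag_block_mat As) \<noteq> 0"
proof -
  have "\<forall>A \<in> set As. square_mat A" using assms by force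
  then show ?thesis using assms by (auto simp: det_diag_block_mat prod_list_zero_iff)
qed

lemma L_mat_carrier:
  assumes "M \<in> carrier_mat s s"
  shows "L_mat N s M \<in> carrier_mat ((N + 1) * s) ((N + 1) * s)"
  using assms unfolding L_mat_def kronecker_def subdiag_mat_def by (intro carrier_matI) auto

section \<open>Block elimination and the Schur complement\<close>

text \<open>The elimination is purely linear, so it works over any field and with \<open>Kt\<close>
  unrelated to \<open>K\<close>. This lets it be applied to complexified real matrices, where no
  conjugation is involved.\<close>

lemma schur_complement_eigenvector:
  fixes G K Kt Gi T :: "'a :: field mat"
  assumes G: "G \<in> carrier_mat n n" and Gi: "Gi \<in> carrier_mat n n" and GiG: "Gi * G = 1\<^sub>m n"
    and K: "K \<in> carrier_mat n m" and Kt: "Kt \<in> carrier_mat m n" and T: "T \<in> carrier_mat m m"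
    and w: "w \<in> carrier_vec n" and z: "z \<in> carrier_vec m"
    and nz: "w @\<^sub>v z \<noteq> 0\<^sub>v (n + m)" and mu: "\<mu> \<noteq> 1"
    and eq: "four_block_mat G K Kt (0\<^sub>m m m) *\<^sub>v (w @\<^sub>v z)
      = \<mu> \<cdot>\<^sub>v (four_block_mat G (0\<^sub>m n m) (0\<^sub>m m n) T *\<^sub>v (w @\<^sub>v z))"
  shows "z \<noteq> 0\<^sub>v m" "(Kt * Gi * K) *\<^sub>v z = (\<mu> * (\<mu> - 1)) \<cdot>\<^sub>v (T *\<^sub>v z)"
proof -
  have smult_append: "\<mu> \<cdot>\<^sub>v (x @\<^sub>v y) = (\<mu> \<cdot>\<^sub>v x) @\<^sub>v (\<mu> \<cdot>\<^sub>v y)" for x y :: "'a vec"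
    by (intro eq_vecI) auto
  have Gw: "G *\<^sub>v w \<in> carrier_vec n" and Kz: "K *\<^sub>v z \<in> carrier_vec n"
    and Ktw: "Kt *\<^sub>v w \<in> carrier_vec m" and Tz: "T *\<^sub>v z \<in> carrier_vec m"
    using G K Kt T w z by auto
  have zero_mult: "0\<^sub>m i j *\<^sub>v v = 0\<^sub>v i" if "v \<in> carrier_vec j" for i j and v :: "'a vec"
    using that by (intro eq_vecI) auto
  have "(G *\<^sub>v w + K *\<^sub>v z) @\<^sub>v (Kt *\<^sub>v w) = (\<mu> \<cdot>\<^sub>v (G *\<^sub>v w)) @\<^sub>v (\<mu> \<cdot>\<^sub>v (T *\<^sub>v z))"
    using eq Gw Kz Ktw Tz w z
    by (simp add: four_block_mat_mult_vec[OF G K Kt zero_carrier_mat w z]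
        four_block_mat_mult_vec[OF G zero_carrier_mat zero_carrier_mat T w z] zero_mult smult_append)
  then have e1: "G *\<^sub>v w + K *\<^sub>v z = \<mu> \<cdot>\<^sub>v (G *\<^sub>v w)" and e2: "Kt *\<^sub>v w = \<mu> \<cdot>\<^sub>v (T *\<^sub>v z)"
    using append_vec_eq[of "G *\<^sub>v w + K *\<^sub>v z" n "\<mu> \<cdot>\<^sub>v (G *\<^sub>v w)"] Gw Kz by auto
  have Kz_eq: "K *\<^sub>v z = (\<mu> - 1) \<cdot>\<^sub>v (G *\<^sub>v w)"
  proof (rule eq_vecI)
    fix i assume "i < dim_vec ((\<mu> - 1) \<cdot>\<^sub>v (G *\<^sub>v w))"
    then have i: "i < n" using G by simp
    \<comment> \<open>The entries of both products are kept opaque, so only a scalar identity g + k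
      = \<mu> g has to be solved for k.\<close>
    have "(G *\<^sub>v w) $ i + (K *\<^sub>v z) $ i = \<mu> * (G *\<^sub>v w) $ i"
      using arg_cong[OF e1, of "\<lambda>v. v $ i"] i G K by (simp del: index_mult_mat_vec)
    then show "(K *\<^sub>v z) $ i = ((\<mu> - 1) \<cdot>\<^sub>v (G *\<^sub>v w)) $ i"
      using i G K by (simp del: index_mult_mat_vec add: algebra_simps)
  qed (use G K in auto)
  have GiKz: "Gi *\<^sub>v (K *\<^sub>v z) = (\<mu> - 1) \<cdot>\<^sub>v w"
    unfolding Kz_eq mult_mat_vec[OF Gi Gw]
    using assoc_mult_mat_vec[OF Gi G w] GiG w by simp
  show "z \<noteq> 0\<^sub>v m"
  proof
    \<comment> \<open>Now the relation for \<open>Gi\<close> applied to \<open>K z\<close> reads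
      (\<mu> - 1) w = 0; dividing by \<mu> - 1 makes the whole eigenvector vanish.\<close>
    assume z0: "z = 0\<^sub>v m"
    have "K *\<^sub>v z = 0\<^sub>v n" unfolding z0 using K by (intro eq_vecI) auto
    moreover have "Gi *\<^sub>v 0\<^sub>v n = 0\<^sub>v n" using Gi by (intro eq_vecI) auto
    ultimately have "(\<mu> - 1) \<cdot>\<^sub>v w = 0\<^sub>v n" using GiKz by simp
    then have "((\<mu> - 1) \<cdot>\<^sub>v w) $ i = 0" if "i < n" for i using that by simp
    then have "w = 0\<^sub>v n" using mu w by (intro eq_vecI) auto
    then show False using nz z0 by (auto simp: append_vec_def)
  qed
  have "(Kt * Gi * K) *\<^sub>v z = Kt *\<^sub>v (Gi *\<^sub>v (K *\<^sub>v z))"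
    using assoc_mult_mat_vec[OF mult_carrier_mat[OF Kt Gi] K z] assoc_mult_mat_vec[OF Kt Gi Kz]
    by simp
  also have "\<dots> = (\<mu> - 1) \<cdot>\<^sub>v (Kt *\<^sub>v w)" unfolding GiKz using mult_mat_vec[OF Kt w] .
  also have "\<dots> = (\<mu> * (\<mu> - 1)) \<cdot>\<^sub>v (T *\<^sub>v z)" unfolding e2 by (simp add: smult_smult_assoc mult.commute)
  finally show "(Kt * Gi * K) *\<^sub>v z = (\<mu> * (\<mu> - 1)) \<cdot>\<^sub>v (T *\<^sub>v z)" .
qed

lemma S_mat_eq_block_product:
  assumes D: "Di \<in> carrier_mat a a" and R: "Ri \<in> carrier_mat b b"
    and L: "L \<in> carrier_mat a m" and H: "H \<in> carrier_mat b m"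
  shows "transpose_mat (L @\<^sub>r H) * four_block_mat Di (0\<^sub>m a b) (0\<^sub>m b a) Ri * (L @\<^sub>r H)
    = transpose_mat L * Di * L + transpose_mat H * Ri * H"
proof -
  \<comment> \<open>The stacked matrix is read as a 2 x 2 block matrix whose second block column has
    width 0, so that the block multiplication rule applies.\<close>
  have K: "L @\<^sub>r H = four_block_mat L (0\<^sub>m a 0) H (0\<^sub>m b 0)"
    using L H unfolding append_rows_def by auto
  have Lt: "transpose_mat L \<in> carrier_mat m a" and Ht: "transpose_mat H \<in> carrier_mat m b"
    using L H by auto
  have LD: "transpose_mat L * Di \<in> carrier_mat m a" and HR: "transpose_mat H * Ri \<in> carrier_mat m b"
    using Lt Ht D R by auto
  have "transpose_mat (L @\<^sub>r H) * four_block_mat Di (0\<^sub>m a b) (0\<^sub>m b a) Ri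
    = four_block_mat (transpose_mat L * Di) (transpose_mat H * Ri) (0\<^sub>m 0 a) (0\<^sub>m 0 b)"
    unfolding K transpose_four_block_mat[OF L zero_carrier_mat H zero_carrier_mat] zero_transpose_mat
    using D R Lt Ht
    by (subst mult_four_block_mat[OF Lt Ht zero_carrier_mat zero_carrier_mat
          D zero_carrier_mat zero_carrier_mat R]) simp
  moreover have "\<dots> * (L @\<^sub>r H)
    = four_block_mat (transpose_mat L * Di * L + transpose_mat H * Ri * H) (0\<^sub>m m 0) (0\<^sub>m 0 m) (0\<^sub>m 0 0)"
    unfolding K using L H LD HR
    by (subst mult_four_block_mat[OF LD HR zero_carrier_mat zero_carrier_mat
          L zero_carrier_mat H zero_carrier_mat])
      (simp add: right_mult_zero_mat[OF LD] right_mult_zero_mat[OF HR])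
  \<comment> \<open>The three blocks of width or height 0 contribute no entries.\<close>
  moreover have "\<dots> = transpose_mat L * Di * L + transpose_mat H * Ri * H"
    using L H by (intro eq_matI) auto
  ultimately show ?thesis by simp
qed

section \<open>Spectra of preconditioned matrices as generalised eigenproblems\<close>

lemma cspectrum_iff:
  assumes "A \<in> carrier_mat n n"
  shows "\<mu> \<in> cspectrum A \<longleftrightarrow> (\<exists>v \<in> carrier_vec n. v \<noteq> 0\<^sub>v n \<and>
    map_mat complex_of_real A *\<^sub>v v = \<mu> \<cdot>\<^sub>v v)"
  using assms unfolding cspectrum_def spectrum_def eigenvalue_def eigenvector_def by auto

text \<open>Multiplying by \<open>P\<close> or by its inverse keeps the eigenvector. Both directions
  matter: one unpacks an eigenpair of the preconditioned saddle point matrix, the other produces one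
  for the preconditioned Schur complement.\<close>

lemma cspectrum_mat_inv_mult_iff:
  assumes P: "P \<in> carrier_mat n n" and A: "A \<in> carrier_mat n n" and "det P \<noteq> 0"
  shows "\<mu> \<in> cspectrum (mat_inv P * A) \<longleftrightarrow> (\<exists>v \<in> carrier_vec n. v \<noteq> 0\<^sub>v n \<and>
    map_mat complex_of_real A *\<^sub>v v = \<mu> \<cdot>\<^sub>v (map_mat complex_of_real P *\<^sub>v v))"
proof -
  let ?c = "map_mat complex_of_real"
  note inv = mat_inv[OF P \<open>det P \<noteq> 0\<close>]
  have c: "?c P \<in> carrier_mat n n" "?c A \<in> carrier_mat n n" "?c (mat_inv P) \<in> carrier_mat n n"
    using P A inv by auto
  \<comment> \<open>Complexification is a ring homomorphism, so it carries the real inverse to the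
    complex one.\<close>
  have PI: "?c P * ?c (mat_inv P) = 1\<^sub>m n" "?c (mat_inv P) * ?c P = 1\<^sub>m n"
    using P inv by (simp_all add: of_real_hom.mat_hom_mult[symmetric] of_real_hom.mat_hom_one)
  have hom: "?c (mat_inv P * A) = ?c (mat_inv P) * ?c A"
    using inv(3) A by (rule of_real_hom.mat_hom_mult)
  have "?c (mat_inv P * A) *\<^sub>v v = \<mu> \<cdot>\<^sub>v v \<longleftrightarrow> ?c A *\<^sub>v v = \<mu> \<cdot>\<^sub>v (?c P *\<^sub>v v)"
    if v: "v \<in> carrier_vec n" for v
  proof
    assume "?c (mat_inv P * A) *\<^sub>v v = \<mu> \<cdot>\<^sub>v v"
    then have "?c P *\<^sub>v (?c (mat_inv P) *\<^sub>v (?c A *\<^sub>v v)) = ?c P *\<^sub>v (\<mu> \<cdot>\<^sub>v v)"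
      unfolding hom assoc_mult_mat_vec[OF c(3,2) v] by simp
    moreover have "?c P *\<^sub>v (?c (mat_inv P) *\<^sub>v (?c A *\<^sub>v v)) = ?c A *\<^sub>v v"
      using assoc_mult_mat_vec[OF c(1,3) mult_mat_vec_carrier[OF c(2) v]] PI c(2) v by simp
    ultimately show "?c A *\<^sub>v v = \<mu> \<cdot>\<^sub>v (?c P *\<^sub>v v)"
      using mult_mat_vec[OF c(1) v] by simp
  next
    assume eq: "?c A *\<^sub>v v = \<mu> \<cdot>\<^sub>v (?c P *\<^sub>v v)"
    have "?c (mat_inv P * A) *\<^sub>v v = ?c (mat_inv P) *\<^sub>v (\<mu> \<cdot>\<^sub>v (?c P *\<^sub>v v))"
      using assoc_mult_mat_vec[OF c(3) c(2) v] unfolding hom eq .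
    also have "\<dots> = \<mu> \<cdot>\<^sub>v (?c (mat_inv P) *\<^sub>v (?c P *\<^sub>v v))"
      using c v by (intro mult_mat_vec) auto
    also have "?c (mat_inv P) *\<^sub>v (?c P *\<^sub>v v) = v"
      using assoc_mult_mat_vec[OF c(3) c(1) v] PI v by simp
    finally show "?c (mat_inv P * A) *\<^sub>v v = \<mu> \<cdot>\<^sub>v v" .
  qed
  then show ?thesis
    using inv(3) A by (subst cspectrum_iff[of _ n]) auto
qed

text \<open>Both spectra are rewritten as generalised eigenproblems, linked by the elimination of
  \<open>w\<close>. The value \<mu> = 1 is excluded because there an eigenvector may have z = 0.
  Nothing is presupposed about \<mu> being real.\<close>

lemma cspectrum_prec_saddle:
  assumes D: "D \<in> carrier_mat a a" and R: "R \<in> carrier_mat b b" and T: "T \<in> carrier_mat m m"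
    and L: "L \<in> carrier_mat a m" and H: "H \<in> carrier_mat b m"
    and dD: "det D \<noteq> 0" and dR: "det R \<noteq> 0" and dT: "det T \<noteq> 0"
    and mu: "\<mu> \<in> cspectrum (mat_inv (prec_diag D R T) * saddle_mat D R H L)" and mu1: "\<mu> \<noteq> 1"
  shows "\<mu> * (\<mu> - 1) \<in> cspectrum (mat_inv T * S_mat D R H L)"
proof -
  let ?c = "map_mat complex_of_real"
  define n where "n = a + b"
  define G where "G = four_block_mat D (0\<^sub>m a b) (0\<^sub>m b a) R"
  define Gi where "Gi = four_block_mat (mat_inv D) (0\<^sub>m a b) (0\<^sub>m b a) (mat_inv R)"
  define K where "K = L @\<^sub>r H"
  note iD = mat_inv[OF D dD] and iR = mat_inv[OF R dR]
  have G: "G \<in> carrier_mat n n" and Gi: "Gi \<in> carrier_mat n n" and K: "K \<in> carrier_mat n m"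
    unfolding G_def Gi_def K_def n_def using D R iD iR L H by auto
  have Kt: "transpose_mat K \<in> carrier_mat m n" using K by auto
  have GiG: "Gi * G = 1\<^sub>m n"
    unfolding G_def Gi_def n_def
    using D R iD iR by (subst mult_four_block_mat[of _ a a _ b _ b _ _ a _ b]) auto
  have DR: "diag_block_mat [D, R] = G" 
    using diag_block_mat_last[of "[D]" R] D R unfolding G_def
    by (simp del: diag_block_mat.simps add: Let_def)
  have A: "saddle_mat D R H L = four_block_mat G K (transpose_mat K) (0\<^sub>m m m)"
    unfolding saddle_mat_def DR K_def using L by auto
  \<comment> \<open>The recursion of \<open>diag_block_mat\<close> groups the blocks as D | (R, T);
    splitting off the last block instead gives the grouping (D, R) | T that matches
    \<open>saddle_mat\<close>.\<close>
  have P: "prec_diag D R T = four_block_mat G (0\<^sub>m n m) (0\<^sub>m m n) T"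
    using diag_block_mat_last[of "[D, R]" T] G T DR unfolding prec_diag_def
    by (simp del: diag_block_mat.simps add: Let_def)
  have Ac: "saddle_mat D R H L \<in> carrier_mat (n + m) (n + m)"
    and Pc: "prec_diag D R T \<in> carrier_mat (n + m) (n + m)"
    unfolding A P using G K T by auto
  have dP: "det (prec_diag D R T) \<noteq> 0"
    unfolding prec_diag_def using D R T dD dR dT by (subst det_diag_block_mat) auto
  have map_four: "?c (four_block_mat E F F' E') = four_block_mat (?c E) (?c F) (?c F') (?c E')"
    if "E \<in> carrier_mat n n" "F \<in> carrier_mat n m" "F' \<in> carrier_mat m n" "E' \<in> carrier_mat m m"
    for E F F' E'
    using that by (intro eq_matI) auto
  have map_zero: "?c (0\<^sub>m i j) = 0\<^sub>m i j" for i j by (intro eq_matI) auto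
  from mu[unfolded cspectrum_mat_inv_mult_iff[OF Pc Ac dP]]
  obtain v where v: "v \<in> carrier_vec (n + m)" "v \<noteq> 0\<^sub>v (n + m)"
    and ev: "?c (saddle_mat D R H L) *\<^sub>v v = \<mu> \<cdot>\<^sub>v (?c (prec_diag D R T) *\<^sub>v v)" by auto
  define w z where "w = vec_first v n" and "z = vec_last v m"
  have w: "w \<in> carrier_vec n" and z: "z \<in> carrier_vec m" and vwz: "v = w @\<^sub>v z"
    using v unfolding w_def z_def by auto
  have "?c Gi * ?c G = 1\<^sub>m n"
    by (simp add: of_real_hom.mat_hom_mult[OF Gi G, symmetric] GiG of_real_hom.mat_hom_one)
  \<comment> \<open>All matrices are complexified here; \<open>this\<close> is the fact that
    \<open>?c Gi\<close> is still a left inverse of \<open>?c G\<close>.\<close>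
  note schur = schur_complement_eigenvector[of "?c G" n "?c Gi" "?c K" m "?c (transpose_mat K)" "?c T" w z \<mu>,
      OF _ _ this _ _ _ w z _ mu1]
  have z0: "z \<noteq> 0\<^sub>v m" and
    Sz: "(?c (transpose_mat K) * ?c Gi * ?c K) *\<^sub>v z = (\<mu> * (\<mu> - 1)) \<cdot>\<^sub>v (?c T *\<^sub>v z)"
    using schur G Gi K Kt T v ev
    unfolding A P map_four[OF G K Kt zero_carrier_mat] map_zero
      map_four[OF G zero_carrier_mat zero_carrier_mat T] vwz
    by auto
  have S: "S_mat D R H L = transpose_mat K * Gi * K"
    unfolding S_mat_def K_def Gi_def using S_mat_eq_block_product[OF iD(3) iR(3) L H] ..
  have Sc: "S_mat D R H L \<in> carrier_mat m m" unfolding S using K by auto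
  have "?c (S_mat D R H L) = ?c (transpose_mat K) * ?c Gi * ?c K"
    unfolding S of_real_hom.mat_hom_mult[OF mult_carrier_mat[OF Kt Gi] K]
      of_real_hom.mat_hom_mult[OF Kt Gi] ..
  with Sz z z0 show ?thesis
    unfolding cspectrum_mat_inv_mult_iff[OF T Sc dT] by auto
qed

section \<open>Roots of the quadratic and the resulting bounds\<close>

text \<open>Completing the square turns the equation into (2 \<mu> - 1)^2 = q^2 with q the real
  square root of the discriminant. This is the source of the realness of the eigenvalues.\<close>

lemma complex_quadratic_roots:
  fixes \<mu> :: complex and l :: real
  assumes "\<mu> * (\<mu> - 1) = complex_of_real l" and "0 \<le> 1 + 4 * l"
  shows "\<mu> = complex_of_real ((1 - sqrt (1 + 4 * l)) / 2)
    \<or> \<mu> = complex_of_real ((1 + sqrt (1 + 4 * l)) / 2)"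
proof -
  define q where "q = sqrt (1 + 4 * l)"
  have "q\<^sup>2 = 1 + 4 * l" using assms(2) unfolding q_def by simp
  then have "(complex_of_real q)\<^sup>2 = 1 + 4 * (\<mu> * (\<mu> - 1))"
    unfolding assms(1) by (metis of_real_power of_real_add of_real_mult of_real_1 of_real_numeral)
  then have "(2 * \<mu> - 1 + of_real q) * (2 * \<mu> - 1 - of_real q) = 0"
    by (simp add: algebra_simps power2_eq_square)
  then consider "2 * \<mu> - 1 + of_real q = 0" | "2 * \<mu> - 1 - of_real q = 0"
    unfolding mult_eq_0_iff by blast
  then show ?thesis
  proof cases
    case 1
    \<comment> \<open>This map is chosen to send 2 \<mu> - 1 + q to \<mu> and 0 to the root.\<close>
    from arg_cong[OF this, of "\<lambda>x. (x + (1 - of_real q)) / 2"] show ?thesis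
      unfolding q_def[symmetric] by simp
  next
    case 2
    from arg_cong[OF this, of "\<lambda>x. (x + (1 + of_real q)) / 2"] show ?thesis
      unfolding q_def[symmetric] by simp
  qed
qed

theorem proposition7:
  fixes N s p :: nat
    and B M Shat :: "real mat"
    and Q R H :: "nat \<Rightarrow> real mat"
    and lamS LamS :: real
  assumes "N \<ge> 1" and "s \<ge> 1" and "p \<ge> 1"
    and "spd_mat s B"
    and "\<And>i. 1 \<le> i \<Longrightarrow> i \<le> N \<Longrightarrow> spd_mat s (Q i)"
    and "\<And>i. i \<le> N \<Longrightarrow> spd_mat p (R i)"
    and "\<And>i. i \<le> N \<Longrightarrow> H i \<in> carrier_mat p s"
    and "M \<in> carrier_mat s s"
    and "spd_mat ((N + 1) * s) Shat"
    and "0 < lamS" and "lamS \<le> LamS"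
    and "cspectrum (mat_inv Shat * S_mat (D_mat N B Q) (R_mat N R) (H_mat N H) (L_mat N s M))
           \<subseteq> complex_of_real ` {lamS..LamS}"
  shows "cspectrum (mat_inv (prec_diag (D_mat N B Q) (R_mat N R) Shat)
             * saddle_mat (D_mat N B Q) (R_mat N R) (H_mat N H) (L_mat N s M)) \<subseteq> \<real> \<and>
         cspectrum (mat_inv (prec_diag (D_mat N B Q) (R_mat N R) Shat)
             * saddle_mat (D_mat N B Q) (R_mat N R) (H_mat N H) (L_mat N s M))
           \<subseteq> complex_of_real `
               ({(1 - sqrt (1 + 4 * LamS)) / 2 .. (1 - sqrt (1 + 4 * lamS)) / 2} \<union> {1} \<union>
                {(1 + sqrt (1 + 4 * lamS)) / 2 .. (1 + sqrt (1 + 4 * LamS)) / 2})"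
proof -
  let ?n = "(N + 1) * s" and ?k = "(N + 1) * p"
  let ?D = "D_mat N B Q" and ?R = "R_mat N R" and ?H = "H_mat N H" and ?L = "L_mat N s M"
  let ?X = "cspectrum (mat_inv (prec_diag ?D ?R Shat) * saddle_mat ?D ?R ?H ?L)"
  let ?I = "{(1 - sqrt (1 + 4 * LamS)) / 2 .. (1 - sqrt (1 + 4 * lamS)) / 2} \<union> {1} \<union>
    {(1 + sqrt (1 + 4 * lamS)) / 2 .. (1 + sqrt (1 + 4 * LamS)) / 2}"
  have spd: "A \<in> carrier_mat k k \<and> det A \<noteq> 0" if "spd_mat k A" for k A
    using that spd_mat_det_nonzero[OF that] unfolding spd_mat_def by auto
  \<comment> \<open>\<open>B\<close> stands in place of index 0 and the half-open range ends at N,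
    so the list has N + 1 blocks.\<close>
  have blocksD: "A \<in> carrier_mat s s \<and> det A \<noteq> 0" if "A \<in> set (B # map Q [1..<N + 1])" for A
    using that spd[OF assms(4)] spd[OF assms(5)] by (auto simp: less_Suc_eq_le simp del: upt_Suc)
  have blocksR: "A \<in> carrier_mat p p \<and> det A \<noteq> 0" if "A \<in> set (map R [0..<N + 1])" for A
    using that spd[OF assms(6)] by (auto simp: less_Suc_eq_le simp del: upt_Suc)
  have blocksH: "A \<in> carrier_mat p s" if "A \<in> set (map H [0..<N + 1])" for A
    using that assms(7) by (auto simp: less_Suc_eq_le simp del: upt_Suc)
  have "diag_block_mat (B # map Q [1..<N + 1])
      \<in> carrier_mat (length (B # map Q [1..<N + 1]) * s) (length (B # map Q [1..<N + 1]) * s)"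
    using blocksD by (intro diag_block_mat_carrier) blast
  moreover have "length (B # map Q [1..<N + 1]) = N + 1" by simp
  ultimately have D: "?D \<in> carrier_mat ?n ?n" unfolding D_mat_def by (simp only:)
  have detD: "det ?D \<noteq> 0"
    unfolding D_mat_def using blocksD by (rule det_diag_block_mat_nonzero)
  have "diag_block_mat (map R [0..<N + 1])
      \<in> carrier_mat (length (map R [0..<N + 1]) * p) (length (map R [0..<N + 1]) * p)"
    using blocksR by (intro diag_block_mat_carrier) blast
  moreover have "length (map R [0..<N + 1]) = N + 1" by simp
  ultimately have R: "?R \<in> carrier_mat ?k ?k" unfolding R_mat_def by (simp only:)
  have detR: "det ?R \<noteq> 0"
    unfolding R_mat_def using blocksR by (rule det_diag_block_mat_nonzero)
  have "diag_block_mat (map H [0..<N + 1])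
      \<in> carrier_mat (length (map H [0..<N + 1]) * p) (length (map H [0..<N + 1]) * s)"
    using blocksH by (intro diag_block_mat_carrier) blast
  moreover have "length (map H [0..<N + 1]) = N + 1" by simp
  ultimately have H: "?H \<in> carrier_mat ?k ?n" unfolding H_mat_def by (simp only:)
  have T: "Shat \<in> carrier_mat ?n ?n" "det Shat \<noteq> 0" using spd[OF assms(9)] by blast+
  have sub: "?X \<subseteq> complex_of_real ` ?I"
  proof
    fix \<mu> assume mu: "\<mu> \<in> ?X"
    show "\<mu> \<in> complex_of_real ` ?I"
    proof (cases "\<mu> = 1")
      case True
      then have "\<mu> = complex_of_real 1" by simp
      then show ?thesis by blast
    next
      case False
      have "\<mu> * (\<mu> - 1) \<in> cspectrum (mat_inv Shat * S_mat ?D ?R ?H ?L)"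
        by (rule cspectrum_prec_saddle[OF D R T(1) L_mat_carrier[OF assms(8)] H detD detR T(2) mu False])
      with assms(12) obtain l where l: "lamS \<le> l" "l \<le> LamS" and "\<mu> * (\<mu> - 1) = complex_of_real l"
        by fastforce
      \<comment> \<open>Since l is at least \<open>lamS\<close>, which is positive, the discriminant
        is nonnegative.\<close>
      then have roots: "\<mu> = complex_of_real ((1 - sqrt (1 + 4 * l)) / 2)
          \<or> \<mu> = complex_of_real ((1 + sqrt (1 + 4 * l)) / 2)"
        using assms(10) by (intro complex_quadratic_roots) auto
      have "sqrt (1 + 4 * lamS) \<le> sqrt (1 + 4 * l)" "sqrt (1 + 4 * l) \<le> sqrt (1 + 4 * LamS)"
        using l by auto
      \<comment> \<open>The minus branch reverses the order, so \<open>LamS\<close> gives its left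
        end; the plus branch preserves it.\<close>
      moreover have "(1 - q) / 2 \<in> {(1 - u) / 2 .. (1 - r) / 2}" "(1 + q) / 2 \<in> {(1 + r) / 2 .. (1 + u) / 2}"
        if "r \<le> q" "q \<le> u" for q r u :: real
        using that by auto
      ultimately have "(1 - sqrt (1 + 4 * l)) / 2 \<in> ?I" "(1 + sqrt (1 + 4 * l)) / 2 \<in> ?I"
        by (blast intro: UnI1 UnI2)+
      with roots show ?thesis by (metis imageI)
    qed
  qed
  \<comment> \<open>Realness of the spectrum is read off from the inclusion in an image of real
    numbers.\<close>
  also have "complex_of_real ` ?I \<subseteq> \<real>" unfolding Reals_def by (rule image_mono) (rule subset_UNIV)
  finally show ?thesis using sub by (rule conjI)
qed

end
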